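(* Let $0<k<n$, $\mathcal{X}_{n,k}=\{x\in\{0,1\}^n:\mathbf{1}^{\mathsf T}x=k\}$, let $B\in\mathbb{R}^{n\times r}$, $P_B=B^{\mathsf T}\operatorname{conv}(\mathcal{X}_{n,k})$, and $d=\dim P_B$. Then $$|\operatorname{vert}(P_B)|\le R_{\mathrm c}\!\left(\binom n2,d\right)=O(n^{2d-2}),$$ the asymptotic estimate being for fixed $d\ge1$. In the cases $k=0$ and $k=n$ one has $|\operatorname{vert}(P_B)|=1$.
   Context: $\operatorname{vert}(P_B)$ is the vertex set of the polytope $P_B$. $R_{\mathrm c}(N,d)=1$ if $d=0$ or $N=0$, and $R_{\mathrm c}(N,d)=2\sum_{j=0}^{d-1}\binom{N-1}{j}$ if $d\ge1$ and $N\ge1$. *)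

theory Defs
  imports "HOL-Analysis.Analysis" "HOL-Library.Landau_Symbols"
begin

definition hypersimplex_points :: "nat \<Rightarrow> (real ^ 'n) set" where
  "hypersimplex_points k = {x. (\<forall>i. x $ i \<in> {0, 1}) \<and> (\<Sum>i\<in>UNIV. x $ i) = real k}"

(* A matrix in R^(n x r) has type real ^ 'r ^ 'n: n rows, each of length r. *)
definition projected_polytope :: "nat \<Rightarrow> real ^ 'r ^ 'n \<Rightarrow> (real ^ 'r) set" where
  "projected_polytope k B = (\<lambda>x. transpose B *v x) ` (convex hull (hypersimplex_points k))"

definition vert :: "'a::euclidean_space set \<Rightarrow> 'a set" where
  "vert P = {v. v extreme_point_of P}"

definition R_c :: "nat \<Rightarrow> nat \<Rightarrow> nat" where
  "R_c N d = (if d = 0 \<or> N = 0 then 1 else 2 * (\<Sum>j = 0..d - 1. (N - 1) choose j))"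

end

theory Submission imports Defs begin

text \<open>
  A vertex of the projected polytope is the unique maximiser of a linear functional \<open>u\<close>, and the
  maximum of \<open>u\<close> is governed by the order of the numbers \<open>u \<bullet> b\<^sub>i\<close> for the rows \<open>b\<^sub>i\<close> of \<open>B\<close>, that is,
  by the signs of \<open>u \<bullet> (b\<^sub>i - b\<^sub>j)\<close>. The set of functionals exposing a given vertex is open, so \<open>u\<close>
  can be chosen off the hyperplanes orthogonal to the nonzero differences. Hence there are at most
  as many vertices as cells in a central arrangement of at most \<open>n choose 2\<close> hyperplanes in a
  \<open>d\<close>-dimensional space, and these are counted by deletion and restriction.
\<close>

section \<open>Cells of a central hyperplane arrangement\<close>

text \<open>A cell is encoded by the set of those normals that are positive on it.\<close>

definition cells :: "'a::euclidean_space set \<Rightarrow> 'a set \<Rightarrow> 'a set set" where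
  "cells W V = (\<lambda>u. {w \<in> W. 0 < u \<bullet> w}) ` {u \<in> V. \<forall>w \<in> W. u \<bullet> w \<noteq> 0}"

lemma cells_subset_Pow: "cells W V \<subseteq> Pow W"
  by (auto simp: cells_def)

lemma finite_cells: "finite W \<Longrightarrow> finite (cells W V)"
  using cells_subset_Pow finite_subset by blast

lemma cells_eq_empty: "\<forall>u \<in> V. u \<bullet> w = 0 \<Longrightarrow> w \<in> W \<Longrightarrow> cells W V = {}"
  by (auto simp: cells_def)

text \<open>The same functional witnesses both cells: deleting \<open>w\<close> only forgets the
  sign at \<open>w\<close>.\<close>

lemma cells_delete:
  assumes "C \<in> cells (insert w W) V" "w \<notin> W"
  shows "C - {w} \<in> cells W V"
proof -
  obtain u where u: "u \<in> V" "\<forall>x \<in> insert w W. u \<bullet> x \<noteq> 0" "C = {x \<in> insert w W. 0 < u \<bullet> x}"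
    using assms(1) by (auto simp: cells_def)
  have "C - {w} = {x \<in> W. 0 < u \<bullet> x}"
    using u(3) assms(2) by auto
  then show ?thesis
    using u by (auto simp: cells_def)
qed

text \<open>A cell on both sides of the hyperplane \<open>w\<^sup>\<bottom>\<close> meets it, by convexity.\<close>

lemma cells_restrict:
  assumes "subspace V" "w \<notin> W" and C: "C \<in> cells (insert w W) V" "w \<in> C"
    and D: "D \<in> cells (insert w W) V" "w \<notin> D" and eq: "C - {w} = D"
  shows "D \<in> cells W (V \<inter> {u. u \<bullet> w = 0})"
proof -
  obtain u where u: "u \<in> V" "\<forall>x \<in> insert w W. u \<bullet> x \<noteq> 0" "C = {x \<in> insert w W. 0 < u \<bullet> x}"
    using C(1) by (auto simp: cells_def)
  obtain v where v: "v \<in> V" "\<forall>x \<in> insert w W. v \<bullet> x \<noteq> 0" "D = {x \<in> insert w W. 0 < v \<bullet> x}"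
    using D(1) by (auto simp: cells_def)
  have uw: "u \<bullet> w > 0" using C(2) u(3) by auto
  have vw: "v \<bullet> w < 0" using D(2) v by (metis (mono_tags, lifting) insertI1 linorder_neqE_linordered_idom mem_Collect_eq)
  \<comment> \<open>A positive combination of \<open>u\<close> and \<open>v\<close> whose weights
    cancel the products with \<open>w\<close>: up to scaling, the point where the segment from
    \<open>u\<close> to \<open>v\<close> crosses the hyperplane.\<close>
  define z where "z = (- (v \<bullet> w)) *\<^sub>R u + (u \<bullet> w) *\<^sub>R v"
  have z: "z \<bullet> x = (- (v \<bullet> w)) * (u \<bullet> x) + (u \<bullet> w) * (v \<bullet> x)" for x
    by (simp add: z_def inner_left_distrib inner_diff_left)
  have same: "(0 < u \<bullet> x) = (0 < v \<bullet> x)" if "x \<in> W" for x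
    using that assms(2) u(3) v(3) eq by auto
  have sgn: "z \<bullet> x \<noteq> 0 \<and> (0 < z \<bullet> x) = (0 < v \<bullet> x)" if x: "x \<in> W" for x
  proof (cases "0 < v \<bullet> x")
    case True
    then have "0 < u \<bullet> x" using same x by simp
    then have "0 < (- (v \<bullet> w)) * (u \<bullet> x)" "0 < (u \<bullet> w) * (v \<bullet> x)"
      using True uw vw by (simp_all add: mult_neg_pos)
    then show ?thesis unfolding z using True by linarith
  next
    case False
    then have "v \<bullet> x < 0" "u \<bullet> x < 0"
      using same[OF x] u(2) v(2) x by (metis insertI2 linorder_neqE_linordered_idom)+
    then have "(- (v \<bullet> w)) * (u \<bullet> x) < 0" "(u \<bullet> w) * (v \<bullet> x) < 0"
      using uw vw by (auto simp: mult_less_0_iff zero_less_mult_iff)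
    then show ?thesis unfolding z using False by linarith
  qed
  have "z \<in> V"
    unfolding z_def using assms(1) u(1) v(1) by (simp only: subspace_add subspace_scale)
  moreover have "z \<bullet> w = 0" by (simp add: z)
  moreover have "D = {x \<in> W. 0 < z \<bullet> x}"
    using sgn v(3) D(2) by auto
  ultimately show ?thesis
    using sgn by (auto simp: cells_def)
qed

section \<open>Counting cells by deletion and restriction\<close>

lemma sum_choose_pos: "0 < d \<Longrightarrow> 0 < (\<Sum>j<d. m choose j)"
  using member_le_sum[of 0 "{..<d}" "\<lambda>j. m choose j"] by auto

text \<open>Pascal's rule summed over \<open>j\<close>; this is the recurrence that deletion and
  restriction produce.\<close>

lemma sum_choose_Suc:
  "(\<Sum>j<Suc e. Suc m choose j) = (\<Sum>j<Suc e. m choose j) + (\<Sum>j<e. m choose j)"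
  by (simp add: sum.lessThan_Suc_shift sum.distrib del: sum.lessThan_Suc)

text \<open>The normals are arbitrary and \<open>d\<close> is only an upper bound for
  \<open>dim V\<close>, so that the induction hypothesis applies to the same \<open>W\<close> on a
  hyperplane of \<open>V\<close>, where restricted normals may become parallel.\<close>

lemma card_cells:
  fixes W V :: "'a::euclidean_space set"
  assumes "finite W" "W \<noteq> {}" "subspace V" "dim V \<le> d"
  shows "card (cells W V) \<le> 2 * (\<Sum>j<d. (card W - 1) choose j)"
  using assms
proof (induction arbitrary: V d rule: finite_ne_induct)
  case (singleton w)
  show ?case
  proof (cases "d = 0")
    case True
    then have "V \<subseteq> {0}" using singleton by (simp add: dim_eq_0)
    then have "cells {w} V = {}" by (intro cells_eq_empty[of _ w]) auto
    then show ?thesis by simp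
  next
    case False
    have "card (cells {w} V) \<le> card (Pow {w})"
      by (intro card_mono cells_subset_Pow) auto
    also have "\<dots> = 2" by (simp add: card_Pow)
    finally show ?thesis
      using sum_choose_pos[of d "card {w} - 1"] False by linarith
  qed
next
  case (insert w W)
  show ?case
  \<comment> \<open>If \<open>w\<close> is orthogonal to \<open>V\<close>, no point of
    \<open>V\<close> avoids its hyperplane; otherwise restriction lowers the dimension.\<close>
  proof (cases "\<forall>u \<in> V. u \<bullet> w = 0")
    case True
    then have "cells (insert w W) V = {}" by (intro cells_eq_empty[of _ w]) auto
    then show ?thesis by simp
  next
    case False
    let ?H = "V \<inter> {u. u \<bullet> w = 0}"
    have H: "subspace ?H"
      using insert.prems(1) subspace_hyperplane2[of w] by (auto intro: subspace_inter)
    have "dim ?H < dim V"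
    proof (rule dim_psubset)
      have "?H \<subset> V" using False by auto
      then show "span ?H \<subset> span V"
        using H insert.prems(1) by (metis span_eq_iff)
    qed
    then obtain e where d: "d = Suc e" and e: "dim ?H \<le> e"
      using insert.prems(2) by (cases d) auto
    obtain m where m: "card W = Suc m"
      using insert.hyps by (metis card_eq_0_iff not0_implies_Suc)
    let ?A = "cells (insert w W) V"
    \<comment> \<open>Once \<open>w\<close> is deleted, the union of the two families lies among the
      cells of \<open>W\<close>; their intersection consists of cells cut by the hyperplane, hence
      lies among those of \<open>?H\<close>.\<close>
    let ?P = "{C \<in> ?A. w \<in> C}" and ?N = "{C \<in> ?A. w \<notin> C}"
    let ?IP = "(\<lambda>C. C - {w}) ` ?P"
    have fin: "finite ?A" using insert.hyps by (simp add: finite_cells)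
    have sub: "?IP \<union> ?N \<subseteq> cells W V"
      using cells_delete[OF _ \<open>w \<notin> W\<close>] by force
    have int: "?IP \<inter> ?N \<subseteq> cells W ?H"
      using cells_restrict[OF insert.prems(1) \<open>w \<notin> W\<close>] by auto
    have "card ?A = card (?P \<union> ?N)" by (rule arg_cong[of _ _ card]) auto
    also have "\<dots> = card ?P + card ?N"
      using fin by (intro card_Un_disjoint) auto
    also have "card ?P = card ?IP"
      by (rule card_image[symmetric]) (auto simp: inj_on_def)
    also have "card ?IP + card ?N = card (?IP \<union> ?N) + card (?IP \<inter> ?N)"
      using fin by (intro card_Un_Int) auto
    also have "\<dots> \<le> card (cells W V) + card (cells W ?H)"
      using insert.hyps by (intro add_mono card_mono finite_cells sub int)
    also have "\<dots> \<le> 2 * (\<Sum>j<d. m choose j) + 2 * (\<Sum>j<e. m choose j)"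
      using insert.IH[OF insert.prems] insert.IH[OF H e] m by simp
    also have "\<dots> = 2 * (\<Sum>j<d. Suc m choose j)"
      unfolding d sum_choose_Suc by simp
    finally show ?thesis using insert.hyps m by simp
  qed
qed

section \<open>The bound \<open>R_c\<close> for arrangements in a subspace\<close>

lemma R_c_eq: "0 < d \<Longrightarrow> 0 < N \<Longrightarrow> R_c N d = 2 * (\<Sum>j<d. (N - 1) choose j)"
  by (cases d) (auto simp: R_c_def atLeast0AtMost lessThan_Suc_atMost)

lemma R_c_pos: "1 \<le> R_c N d"
proof (cases "d = 0 \<or> N = 0")
  case False
  then show ?thesis using sum_choose_pos[of d "N - 1"] R_c_eq[of d N] by linarith
qed (simp add: R_c_def)

text \<open>Besides monotonicity in the number of normals, this absorbs the degenerate cases: an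
  empty arrangement has at most one cell, a nonempty one in dimension 0 has none, and
  \<open>R_c\<close> is at least 1.\<close>

lemma card_cells_le_R_c:
  fixes W V :: "'a::euclidean_space set"
  assumes "finite W" "subspace V" "card W \<le> N"
  shows "card (cells W V) \<le> R_c N (dim V)"
proof (cases "W = {}")
  case True
  have "card (cells W V) \<le> card (Pow {} :: 'a set set)"
    using cells_subset_Pow True by (intro card_mono) auto
  then show ?thesis using R_c_pos[of N "dim V"] by simp
next
  case False
  then have N: "0 < N" using assms by (metis card_gt_0_iff less_le_trans)
  have *: "card (cells W V) \<le> 2 * (\<Sum>j<dim V. (card W - 1) choose j)"
    using card_cells[OF assms(1) False assms(2)] by simp
  show ?thesis
  proof (cases "dim V = 0")
    case True
    then show ?thesis using * unfolding True by simp
  next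
    case d: False
    have "(\<Sum>j<dim V. (card W - 1) choose j) \<le> (\<Sum>j<dim V. (N - 1) choose j)"
      using assms by (intro sum_mono binomial_right_mono) auto
    then show ?thesis using * R_c_eq[of "dim V" N] d N by linarith
  qed
qed

text \<open>Replacing \<open>u\<close> by its orthogonal projection onto \<open>V\<close> changes no
  product with a vector of \<open>V\<close>. This moves ambient functionals into the direction space
  of the polytope.\<close>

lemma cells_projection:
  fixes u :: "'a::euclidean_space"
  assumes "subspace V" "W \<subseteq> V" "\<forall>w \<in> W. u \<bullet> w \<noteq> 0"
  shows "{w \<in> W. 0 < u \<bullet> w} \<in> cells W V"
proof -
  obtain y z where yz: "y \<in> span V" "\<And>w. w \<in> span V \<Longrightarrow> orthogonal z w" "u = y + z"
    using orthogonal_subspace_decomp_exists[of V u] by metis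
  have "y \<in> V" using yz(1) assms(1) by (metis span_eq_iff)
  have "u \<bullet> w = y \<bullet> w" if "w \<in> W" for w
    using yz(2)[of w] that assms(2) span_superset[of V]
    by (auto simp: yz(3) inner_left_distrib orthogonal_def)
  then show ?thesis
    using \<open>y \<in> V\<close> assms(3) by (auto simp: cells_def intro!: image_eqI[of _ _ y])
qed

section \<open>Vertices of the projected hypersimplex\<close>

text \<open>The image under \<open>transpose B\<close> of the indicator vector of
  \<open>S\<close>.\<close>

definition row_sum :: "real ^ 'r ^ 'n \<Rightarrow> 'n set \<Rightarrow> real ^ 'r" where
  "row_sum B S = (\<Sum>i\<in>S. B $ i)"

lemma hypersimplex_points_eq:
  "hypersimplex_points k = (\<lambda>S. \<chi> i. of_bool (i \<in> S)) ` {S :: 'n::finite set. card S = k}"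
proof (intro equalityI subsetI)
  fix x :: "real ^ 'n"
  assume x: "x \<in> hypersimplex_points k"
  let ?S = "{i. x $ i = 1}"
  have eq: "x $ i = of_bool (i \<in> ?S)" for i
    using x by (auto simp: hypersimplex_points_def)
  have "(\<Sum>i\<in>UNIV. x $ i) = (\<Sum>i\<in>UNIV. of_bool (i \<in> ?S))"
    using eq by simp
  also have "\<dots> = real (card ?S)"
    by (subst sum_of_bool_eq) auto
  finally have "card ?S = k" using x by (simp add: hypersimplex_points_def)
  moreover have "x = (\<chi> i. of_bool (i \<in> ?S))"
    using eq by (simp add: vec_eq_iff)
  ultimately show "x \<in> (\<lambda>S. \<chi> i. of_bool (i \<in> S)) ` {S. card S = k}" by blast
next
  fix x :: "real ^ 'n"
  assume "x \<in> (\<lambda>S. \<chi> i. of_bool (i \<in> S)) ` {S. card S = k}"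
  then show "x \<in> hypersimplex_points k"
    by (auto simp: hypersimplex_points_def sum_of_bool_eq)
qed

lemma transpose_mult_indicator:
  "transpose B *v (\<chi> i. of_bool (i \<in> S)) = row_sum B (S :: 'n::finite set)"
  by (simp add: row_sum_def vec_eq_iff matrix_vector_mult_def transpose_def sum_mult_of_bool_eq
      del: transpose_matrix_vector)

lemma projected_polytope_eq:
  fixes B :: "real ^ 'r::finite ^ 'n::finite"
  shows "projected_polytope k B = convex hull (row_sum B ` {S. card S = k})"
  unfolding projected_polytope_def hypersimplex_points_eq
  by (simp only: convex_hull_linear_image[OF matrix_vector_mul_linear] image_image
      transpose_mult_indicator)

lemma vert_projected_polytope_subset:
  fixes B :: "real ^ 'r::finite ^ 'n::finite"
  shows "vert (projected_polytope k B) \<subseteq> row_sum B ` {S. card S = k}"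
  unfolding vert_def projected_polytope_eq
  using extreme_point_of_convex_hull by blast

section \<open>Generic functionals exposing a vertex\<close>

lemma finite_convex_hull_extreme_point_exposed:
  fixes v :: "'a::euclidean_space"
  assumes "finite Y" "v extreme_point_of (convex hull Y)"
  obtains a where "\<And>y. y \<in> Y \<Longrightarrow> y \<noteq> v \<Longrightarrow> a \<bullet> y < a \<bullet> v"
proof -
  have "polyhedron (convex hull Y)"
    using assms(1) by (simp add: polyhedron_convex_hull)
  moreover have "{v} face_of (convex hull Y)"
    using assms(2) by (simp add: face_of_singleton)
  \<comment> \<open>Every face of a polyhedron is exposed.\<close>
  ultimately have "{v} exposed_face_of (convex hull Y)"
    by (simp add: exposed_face_of_polyhedron)
  then obtain a b where ab: "convex hull Y \<subseteq> {x. a \<bullet> x \<le> b}"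
    "{v} = convex hull Y \<inter> {x. a \<bullet> x = b}"
    by (auto simp: exposed_face_of_def)
  show thesis
  proof (rule that[of a])
    fix y assume y: "y \<in> Y" "y \<noteq> v"
    have "y \<in> convex hull Y" using y(1) by (simp add: hull_inc)
    then have "a \<bullet> y \<le> b" "a \<bullet> y \<noteq> b" using ab y(2) by blast+
    moreover have "a \<bullet> v = b" using ab(2) by blast
    ultimately show "a \<bullet> y < a \<bullet> v" by simp
  qed
qed

text \<open>The exposing functionals form a nonempty open set, whereas the hyperplanes are null sets.\<close>

lemma finite_convex_hull_extreme_point_generic:
  fixes v :: "'a::euclidean_space"
  assumes "finite Y" "v extreme_point_of (convex hull Y)" and W: "finite W" "0 \<notin> W"
  obtains u where "\<And>y. y \<in> Y \<Longrightarrow> y \<noteq> v \<Longrightarrow> u \<bullet> y < u \<bullet> v" "\<forall>w \<in> W. u \<bullet> w \<noteq> 0"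
proof -
  let ?O = "\<Inter>y\<in>Y - {v}. {u. u \<bullet> y < u \<bullet> v}"
  have "open ?O"
    using assms(1) by (intro open_INT ballI open_Collect_less continuous_intros) auto
  moreover have "?O \<noteq> {}"
    using finite_convex_hull_extreme_point_exposed[OF assms(1,2)] by (metis (mono_tags, lifting)
        DiffE INT_I empty_iff insertCI mem_Collect_eq)
  ultimately have "\<not> negligible ?O" by (rule open_not_negligible)
  moreover have "negligible (\<Union>w\<in>W. {u. w \<bullet> u = 0})"
    using W by (intro negligible_Union finite_imageI) (auto intro!: negligible_hyperplane)
  ultimately obtain u where "u \<in> ?O" "u \<notin> (\<Union>w\<in>W. {u. w \<bullet> u = 0})"
    by (meson negligible_subset subsetI)
  then show thesis
    by (intro that[of u]) (auto simp: inner_commute)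
qed

section \<open>Exchange arguments and row differences\<close>

lemma sum_le_by_exchange:
  fixes f :: "'n \<Rightarrow> 'b::ordered_comm_monoid_add"
  assumes "finite S" "finite T" "card S = card T"
    and le: "\<And>i j. i \<in> S - T \<Longrightarrow> j \<in> T - S \<Longrightarrow> f i \<le> f j"
  shows "sum f S \<le> sum f T"
proof -
  \<comment> \<open>The differences have equal size, so a bijection compares them term by term; the
    common part contributes equally.\<close>
  have "card (S - T) = card (T - S)"
    using assms(1-3) by (metis card_le_sym_Diff le_antisym order_refl)
  then obtain h where h: "bij_betw h (S - T) (T - S)"
    using assms(1,2) by (metis finite_Diff finite_same_card_bij)
  have "sum f (S - T) \<le> sum (\<lambda>i. f (h i)) (S - T)"
    using h le by (intro sum_mono) (auto simp: bij_betw_def)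
  also have "\<dots> = sum f (T - S)"
    by (rule sum.reindex_bij_betw[OF h])
  finally have "sum f (S - T) + sum f (S \<inter> T) \<le> sum f (T - S) + sum f (T \<inter> S)"
    by (simp add: Int_commute add_right_mono)
  then show ?thesis
    using assms(1,2) by (metis add.commute sum.Int_Diff)
qed

lemma row_sum_exchange:
  fixes B :: "real ^ 'r::finite ^ 'n::finite"
  assumes "i \<in> S" "j \<notin> S"
  shows "card (insert j (S - {i})) = card S"
    and "row_sum B S - row_sum B (insert j (S - {i})) = B $ i - B $ j"
proof -
  show "card (insert j (S - {i})) = card S"
    using assms card.remove[of S i] by simp
  have "row_sum B S = B $ i + row_sum B (S - {i})"
    unfolding row_sum_def using assms by (simp add: sum.remove)
  moreover have "row_sum B (insert j (S - {i})) = B $ j + row_sum B (S - {i})"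
    unfolding row_sum_def using assms by simp
  ultimately show "row_sum B S - row_sum B (insert j (S - {i})) = B $ i - B $ j"
    by simp
qed

text \<open>Some \<open>k\<close>-set contains \<open>i\<close> but not \<open>j\<close>; exchanging
  \<open>i\<close> for \<open>j\<close> gives two points of the polytope whose difference is the row
  difference, and the translation cancels.\<close>

lemma row_difference_in_translate:
  fixes B :: "real ^ 'r::finite ^ 'n::finite"
  assumes "0 < k" "k < CARD('n)"
  shows "B $ i - B $ j \<in> span ((+) (- a) ` projected_polytope k B)" (is "_ \<in> ?V")
proof (cases "i = j")
  case True
  then show ?thesis by (simp add: span_zero)
next
  case False
  \<comment> \<open>The bound \<open>k < CARD('n)\<close> leaves enough indices to complete
    \<open>i\<close> to a \<open>k\<close>-set avoiding \<open>j\<close>.\<close>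
  have "k - 1 \<le> card (UNIV - {i, j})"
    using assms False by (simp add: card_Diff_subset)
  then obtain R where R: "R \<subseteq> UNIV - {i, j}" "card R = k - 1"
    by (meson obtain_subset_with_card_n)
  let ?S = "insert i R"
  have S: "card ?S = k" "i \<in> ?S" "j \<notin> ?S"
    using R assms False by (auto simp: card_insert_if)
  let ?T = "insert j (?S - {i})"
  have in_P: "row_sum B U \<in> projected_polytope k B" if "card U = k" for U
    using that unfolding projected_polytope_eq by (auto intro: hull_inc)
  have "- a + row_sum B ?S \<in> ?V" "- a + row_sum B ?T \<in> ?V"
    using in_P S row_sum_exchange(1)[OF S(2,3)] by (auto intro!: span_base)
  then have "(- a + row_sum B ?S) - (- a + row_sum B ?T) \<in> ?V"
    by (rule span_diff)
  also have "(- a + row_sum B ?S) - (- a + row_sum B ?T) = B $ i - B $ j"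
    using row_sum_exchange(2)[OF S(2,3), of B] by (simp add: algebra_simps)
  finally show ?thesis .
qed

text \<open>One normal is chosen from each pair \<open>\<plusminus>(b\<^sub>i - b\<^sub>j)\<close>, so that there are at most
  \<open>n choose 2\<close> of them.\<close>

lemma obtain_row_differences:
  fixes B :: "real ^ 'r::finite ^ 'n::finite"
  obtains W where "finite W" "card W \<le> CARD('n) choose 2" "0 \<notin> W"
    "W \<subseteq> range (\<lambda>(i, j). B $ i - B $ j)"
    "\<And>i j. B $ i \<noteq> B $ j \<Longrightarrow> B $ i - B $ j \<in> W \<or> B $ j - B $ i \<in> W"
proof -
  let ?E = "{A :: 'n set. card A = 2}"
  have "\<forall>A \<in> ?E. \<exists>w. \<exists>i j. A = {i, j} \<and> w = B $ i - B $ j"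
  proof
    fix A :: "'n set" assume "A \<in> ?E"
    then obtain i j where "A = {i, j}" by (auto simp: card_2_iff)
    then show "\<exists>w. \<exists>i j. A = {i, j} \<and> w = B $ i - B $ j" by blast
  qed
  from bchoice[OF this] obtain g where
    g: "\<forall>A \<in> ?E. \<exists>i j. A = {i, j} \<and> g A = B $ i - B $ j" ..
  \<comment> \<open>Equal rows give the zero vector, which defines no hyperplane.\<close>
  let ?W = "g ` ?E - {0}"
  show thesis
  proof (rule that[of ?W])
    have "card ?W \<le> card (g ` ?E)" by (rule card_mono) auto
    also have "\<dots> \<le> card ?E" by (rule card_image_le) auto
    also have "\<dots> = CARD('n) choose 2"
      using n_subsets[of "UNIV :: 'n set" 2] by simp
    finally show "card ?W \<le> CARD('n) choose 2" .
    show "?W \<subseteq> range (\<lambda>(i, j). B $ i - B $ j)" using g by fastforce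
    show "B $ i - B $ j \<in> ?W \<or> B $ j - B $ i \<in> ?W" if ne: "B $ i \<noteq> B $ j" for i j
    proof -
      have "i \<noteq> j" using ne by auto
      then have A: "{i, j} \<in> ?E" by simp
      then obtain p q where "{i, j} = {p, q}" "g {i, j} = B $ p - B $ q" using g by blast
      then have "g {i, j} = B $ i - B $ j \<or> g {i, j} = B $ j - B $ i"
        by (auto simp: doubleton_eq_iff)
      moreover have "g {i, j} \<in> g ` ?E" using A by (rule imageI)
      ultimately show ?thesis using ne by auto
    qed
  qed auto
qed

section \<open>The injection from vertices to cells\<close>

lemma card_vert_projected_polytope:
  fixes B :: "real ^ 'r::finite ^ 'n::finite"
  assumes k: "0 < k" "k < CARD('n)"
  shows "card (vert (projected_polytope k B))
    \<le> R_c (CARD('n) choose 2) (nat (aff_dim (projected_polytope k B)))"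
proof -
  let ?P = "projected_polytope k B" and ?Y = "row_sum B ` {S. card S = k}"
  obtain a where a: "a \<in> ?P"
  proof -
    obtain S :: "'n set" where "card S = k"
      using k obtain_subset_with_card_n[of k "UNIV :: 'n set"] by auto
    then have "row_sum B S \<in> ?P" unfolding projected_polytope_eq by (auto intro: hull_inc)
    then show thesis by (rule that)
  qed
  let ?V = "span ((+) (- a) ` ?P)"
  \<comment> \<open>The polytope is nonempty, so its affine dimension is nonnegative and
    \<open>nat\<close> loses nothing.\<close>
  have dim: "dim ?V = nat (aff_dim ?P)"
    using aff_dim_eq_dim[of a ?P] a by (simp add: hull_inc)
  obtain W where W: "finite W" "card W \<le> CARD('n) choose 2" "0 \<notin> W"
    "W \<subseteq> range (\<lambda>(i, j). B $ i - B $ j)"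
    and cover: "\<And>i j. B $ i \<noteq> B $ j \<Longrightarrow> B $ i - B $ j \<in> W \<or> B $ j - B $ i \<in> W"
    using obtain_row_differences[of B] by metis
  have WV: "W \<subseteq> ?V"
    using W(4) row_difference_in_translate[OF k, of B] by auto
  define exposes where
    "exposes u v \<longleftrightarrow> (\<forall>y \<in> ?Y. y \<noteq> v \<longrightarrow> u \<bullet> y < u \<bullet> v) \<and> (\<forall>w \<in> W. u \<bullet> w \<noteq> 0)" for u v
  have "\<exists>u. exposes u v" if "v \<in> vert ?P" for v
  proof -
    have ext: "v extreme_point_of (convex hull ?Y)"
      using that by (simp add: vert_def projected_polytope_eq)
    have "finite ?Y" by simp
    then obtain u where "\<And>y. y \<in> ?Y \<Longrightarrow> y \<noteq> v \<Longrightarrow> u \<bullet> y < u \<bullet> v" "\<forall>w \<in> W. u \<bullet> w \<noteq> 0"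
      using finite_convex_hull_extreme_point_generic[OF _ ext W(1,3)] by blast
    then show ?thesis unfolding exposes_def by blast
  qed
  then obtain f where f: "\<And>v. v \<in> vert ?P \<Longrightarrow> exposes (f v) v" by metis
  \<comment> \<open>Each vertex is sent to the cell of a chosen generic functional exposing
    it.\<close>
  let ?c = "\<lambda>v. {w \<in> W. 0 < f v \<bullet> w}"
  have "inj_on ?c (vert ?P)"
  proof (rule inj_onI, rule ccontr)
    fix v v'
    assume v: "v \<in> vert ?P" "v' \<in> vert ?P" and eq: "?c v = ?c v'" and ne: "v \<noteq> v'"
    obtain S where S: "card S = k" "v = row_sum B S"
      using v(1) vert_projected_polytope_subset[of k B] by blast
    obtain T where T: "card T = k" "v' = row_sum B T"
      using v(2) vert_projected_polytope_subset[of k B] by blast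
    have same: "(0 < f v \<bullet> w) = (0 < f v' \<bullet> w)" "f v \<bullet> w \<noteq> 0" "f v' \<bullet> w \<noteq> 0" if "w \<in> W" for w
      using that eq f[OF v(1)] f[OF v(2)] by (auto simp: exposes_def)
    \<comment> \<open>Since \<open>T\<close> maximises \<open>f v'\<close>, single exchanges order
      the values of \<open>f v'\<close> on the rows; equal cells carry this order over to
      \<open>f v\<close>, so \<open>v'\<close> does at least as well as \<open>v\<close> under
      \<open>f v\<close>, which exposes \<open>v\<close>.\<close>
    have "(\<Sum>i\<in>S. f v \<bullet> (B $ i)) \<le> (\<Sum>i\<in>T. f v \<bullet> (B $ i))"
    proof (rule sum_le_by_exchange)
      fix j i assume ij: "j \<in> S - T" "i \<in> T - S"
      then have i: "i \<in> T" "j \<notin> T" by auto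
      let ?T = "insert j (T - {i})"
      have "row_sum B ?T \<in> ?Y"
        using row_sum_exchange(1)[OF i] T(1) by auto
      then have "f v' \<bullet> row_sum B ?T \<le> f v' \<bullet> row_sum B T"
        using f[OF v(2)] T(2) unfolding exposes_def by (metis less_le order_refl)
      then have "0 \<le> f v' \<bullet> (row_sum B T - row_sum B ?T)"
        by (simp add: inner_diff_right)
      then have ge: "0 \<le> f v' \<bullet> (B $ i - B $ j)"
        using row_sum_exchange(2)[OF i, of B] by simp
      have "0 \<le> f v \<bullet> (B $ i - B $ j)"
      proof (cases "B $ i = B $ j")
        case False
        from cover[OF this] show ?thesis
        proof
          assume "B $ i - B $ j \<in> W"
          from same[OF this] ge show ?thesis by linarith
        next
          assume "B $ j - B $ i \<in> W"
          from same[OF this] ge show ?thesis by (simp add: inner_diff_right)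
        qed
      qed simp
      then show "f v \<bullet> (B $ j) \<le> f v \<bullet> (B $ i)" by (simp add: inner_diff_right)
    qed (use S T in auto)
    then have "f v \<bullet> v \<le> f v \<bullet> v'"
      by (simp add: S(2) T(2) row_sum_def inner_sum_right)
    moreover have "v' \<in> ?Y" using T by auto
    ultimately show False
      using f[OF v(1)] ne unfolding exposes_def by (metis not_less)
  qed
  moreover have "?c ` vert ?P \<subseteq> cells W ?V"
    using f WV by (auto simp: exposes_def intro!: cells_projection)
  ultimately have "card (vert ?P) \<le> card (cells W ?V)"
    by (meson card_inj_on_le W(1) finite_cells)
  also have "\<dots> \<le> R_c (CARD('n) choose 2) (dim ?V)"
    using W by (intro card_cells_le_R_c) auto
  finally show ?thesis unfolding dim .
qed

section \<open>Extremal \<open>k\<close> and asymptotic growth\<close>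

lemma card_vert_projected_polytope_extremal:
  fixes B :: "real ^ 'r::finite ^ 'n::finite"
  assumes "k = 0 \<or> k = CARD('n)"
  shows "card (vert (projected_polytope k B)) = 1"
proof -
  \<comment> \<open>Only the empty set or the full index set has size \<open>k\<close>, so the
    polytope is a point.\<close>
  have "\<exists>U. {S :: 'n set. card S = k} = {U}"
    using assms card_subset_eq[of "UNIV :: 'n set"] by (cases "k = 0") auto
  then obtain U where "{S :: 'n set. card S = k} = {U}" by blast
  then have "vert (projected_polytope k B) = {row_sum B U}"
    by (auto simp: vert_def projected_polytope_eq extreme_point_of_def)
  then show ?thesis by simp
qed

lemma R_c_le:
  assumes "1 \<le> n" "1 \<le> d"
  shows "R_c (n choose 2) d \<le> 2 * d * n ^ (2 * d - 2)"
proof (cases "n choose 2 = 0")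
  case True
  \<comment> \<open>Here \<open>n = 1\<close>, and \<open>R_c\<close> takes its default value
    1.\<close>
  have "1 * 1 \<le> d * n ^ (2 * d - 2)" using assms by (intro mult_mono) auto
  then show ?thesis using True by (simp add: R_c_def)
next
  case False
  \<comment> \<open>The exponent comes from the top term \<open>j = d - 1\<close>, as
    \<open>n choose 2\<close> is at most \<open>n ^ 2\<close>.\<close>
  have "(n choose 2) - 1 choose j \<le> n ^ (2 * d - 2)" if "j < d" for j
  proof (cases "j \<le> (n choose 2) - 1")
    case True
    then have "(n choose 2) - 1 choose j \<le> ((n choose 2) - 1) ^ j" by (rule binomial_le_pow)
    also have "\<dots> \<le> (n ^ 2) ^ j"
      using binomial_le_pow[of 2 n] False by (intro power_mono) (auto simp: binomial_eq_0_iff)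
    also have "\<dots> = n ^ (2 * j)" by (simp add: power_mult)
    also have "\<dots> \<le> n ^ (2 * d - 2)"
      using assms that by (intro power_increasing) auto
    finally show ?thesis .
  qed (simp add: binomial_eq_0)
  then have "(\<Sum>j<d. (n choose 2) - 1 choose j) \<le> (\<Sum>j<d. n ^ (2 * d - 2))"
    by (intro sum_mono) auto
  then show ?thesis using assms False by (simp add: R_c_eq)
qed

text \<open>Finiteness is stated separately because \<open>card\<close> is 0 on infinite sets. The
  asymptotic part concerns \<open>R_c\<close> with \<open>n\<close> a free natural number, since
  \<open>CARD('n)\<close> is fixed by the type.\<close>

theorem corollary5p4:
  fixes B :: "real ^ 'r::finite ^ 'n::finite" and k :: nat
  shows
    "(0 < k \<and> k < CARD('n) \<longrightarrow>
        finite (vert (projected_polytope k B)) \<and>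
        card (vert (projected_polytope k B))
          \<le> R_c (CARD('n) choose 2) (nat (aff_dim (projected_polytope k B)))) \<and>
     (\<forall>d::nat. d \<ge> 1 \<longrightarrow>
        (\<lambda>n::nat. real (R_c (n choose 2) d)) \<in> O(\<lambda>n. real n ^ (2 * d - 2))) \<and>
     (k = 0 \<or> k = CARD('n) \<longrightarrow> card (vert (projected_polytope k B)) = 1)"
proof (intro conjI impI allI)
  show "finite (vert (projected_polytope k B))"
    using vert_projected_polytope_subset[of k B] by (rule finite_subset) simp
next
  fix d :: nat
  assume d: "1 \<le> d"
  show "(\<lambda>n::nat. real (R_c (n choose 2) d)) \<in> O(\<lambda>n. real n ^ (2 * d - 2))"
  proof (rule bigoI)
    show "\<forall>\<^sub>F n in sequentially.
        norm (real (R_c (n choose 2) d)) \<le> real (2 * d) * norm (real n ^ (2 * d - 2))"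
      using eventually_ge_at_top[of "1::nat"]
    proof eventually_elim
      case (elim n)
      from R_c_le[OF elim d] have "real (R_c (n choose 2) d) \<le> real (2 * d * n ^ (2 * d - 2))"
        by (rule of_nat_mono)
      then show ?case by simp
    qed
  qed
next
  assume "0 < k \<and> k < CARD('n)"
  then show "card (vert (projected_polytope k B))
      \<le> R_c (CARD('n) choose 2) (nat (aff_dim (projected_polytope k B)))"
    using card_vert_projected_polytope by blast
qed (rule card_vert_projected_polytope_extremal)

end
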